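(* Let $d \geq 2$ and let $P(X) \in \mathbb{Z}[X]$ be a monic polynomial of degree $d$ with $P(\mathbb{N})\subset \mathbb{N}$. Let $\mathcal{T}_P=(t(P(n)))_{n\geq 0}$ be the subsequence of the Thue--Morse sequence along $(P(n))_{n\ge 0}$. Then $$M(\mathcal{T}_P,N) \gg N^{1/d},$$ where the implied constant depends only on $P$; that is, there exist a constant $c>0$ and an integer $N_0$, both depending only on $P$, such that $M(\mathcal{T}_P,N)\geq c\,N^{1/d}$ for all integers $N\geq N_0$.
   Context: $\mathbb{N}$ denotes the set of nonnegative integers. Thue--Morse sequence: for an integer $n\geq 0$ with binary expansion $n=\sum_{i\geq 0}\varepsilon_i 2^i$, $\varepsilon_i\in\{0,1\}$, put $s_1(n)=\sum_{i\geq 0}\varepsilon_i$ and $t(n)=s_1(n)\bmod 2\in\{0,1\}$. Maximum order complexity: let $N\geq 2$ be an integer and $\mathcal{S}=(s_n)_{n\geq 0}$ a sequence over $\{0,1\}$ (identified with $\mathbb{F}_2$). If $(s_0,\ldots,s_{N-2})$ is not constant, the $N$th maximum order complexity $M(\mathcal{S},N)$ is the smallest positive integer $M$ such that there is a polynomial $f(x_1,\ldots,x_M)$ over $\mathbb{F}_2$ with $$s_{i+M}=f(s_i,\ldots,s_{i+M-1}),\qquad 0\leq i\leq N-M-1.$$ If $s_i=a$ for all $i=0,\ldots,N-2$ (with $a\in\{0,1\}$), then $M(\mathcal{S},N)=0$ if $s_{N-1}=a$, and $M(\mathcal{S},N)=N-1$ otherwise. *)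

theory Defs
  imports
    Complex_Main
    "HOL-Library.Z2"
    "HOL-Library.Groups_Big_Fun"
    "HOL-Library.Poly_Mapping"
    "HOL-Computational_Algebra.Polynomial"
begin

(* The sum runs over all i; it is finite by finite_binary_digits, as Sum_any requires. *)
definition binary_digit_sum :: "nat \<Rightarrow> nat" where
  "binary_digit_sum n = Sum_any (\<lambda>i. n div 2 ^ i mod 2)"

lemma finite_binary_digits: "finite {i. n div 2 ^ i mod 2 \<noteq> (0::nat)}"
proof (rule finite_subset)
  show "{i. n div 2 ^ i mod 2 \<noteq> 0} \<subseteq> {..n}"
  proof
    fix i assume "i \<in> {i. n div 2 ^ i mod 2 \<noteq> 0}"
    then have "n div 2 ^ i mod 2 \<noteq> 0" by (rule CollectD)
    then have "\<not> n < 2 ^ i" by (intro notI) (simp only: div_less mod_0 simp_thms)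
    then have "2 ^ i \<le> n" by (simp only: not_less)
    with less_exp[of i] show "i \<in> {..n}" unfolding atMost_iff by linarith
  qed
qed simp

definition thue_morse :: "nat \<Rightarrow> bit" where
  "thue_morse n = of_nat (binary_digit_sum n mod 2)"

(* A polynomial over the field bit = GF(2) maps exponent vectors to coefficients.  Variables are
   indexed from 0, so polynomials in M variables are those with vars in {..<M}. *)
type_synonym mpoly2 = "(nat \<Rightarrow>\<^sub>0 nat) \<Rightarrow>\<^sub>0 bit"

definition mpoly2_vars :: "mpoly2 \<Rightarrow> nat set" where
  "mpoly2_vars f = (\<Union>m\<in>Poly_Mapping.keys f. Poly_Mapping.keys m)"

definition mpoly2_eval :: "mpoly2 \<Rightarrow> (nat \<Rightarrow> bit) \<Rightarrow> bit" where
  "mpoly2_eval f x = (\<Sum>m\<in>Poly_Mapping.keys f. Poly_Mapping.lookup f m * (\<Prod>j\<in>Poly_Mapping.keys m. x j ^ Poly_Mapping.lookup m j))"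

definition has_recurrence :: "(nat \<Rightarrow> bit) \<Rightarrow> nat \<Rightarrow> nat \<Rightarrow> bool" where
  "has_recurrence s N M \<longleftrightarrow>
     (\<exists>f. mpoly2_vars f \<subseteq> {..<M} \<and>
       (\<forall>i. i + M < N \<longrightarrow> s (i + M) = mpoly2_eval f (\<lambda>j. s (i + j))))"

(* Meaningful for N \<ge> 2 only. *)
definition max_order_complexity :: "(nat \<Rightarrow> bit) \<Rightarrow> nat \<Rightarrow> nat" where
  "max_order_complexity s N =
     (if \<forall>i<N - 1. s i = s 0
      then (if s (N - 1) = s 0 then 0 else N - 1)
      else (LEAST M. M > 0 \<and> has_recurrence s N M))"

lemma has_recurrence_exists:
  assumes "N \<ge> 2"
  shows "\<exists>M>0. has_recurrence s N M"
proof -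
  have "has_recurrence s N N"
    unfolding has_recurrence_def mpoly2_vars_def by (rule exI[of _ 0]) simp
  then show ?thesis using assms by (intro exI[of _ N]) simp
qed

definition thue_morse_along :: "int poly \<Rightarrow> nat \<Rightarrow> bit" where
  "thue_morse_along P n = thue_morse (nat (poly P (int n)))"

end

theory Submission imports Defs begin

text \<open>
  Write \<open>t\<close> for the Thue--Morse sequence. If the same window of \<open>k\<close> terms occurs at two places
  among the first \<open>N\<close> terms of a sequence and is continued differently, then no function of
  \<open>k\<close> or fewer preceding terms generates the sequence up to \<open>N\<close>, so its complexity exceeds \<open>k\<close>
  (\<open>max_order_complexity_gt\<close>). Such a window is found near two consecutive powers of two.

  After translating the argument (\<open>shifted_nat_poly\<close>), \<open>P\<close> becomes a polynomial \<open>R\<close> of degree \<open>d\<close>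
  with positive coefficients. Expand \<open>R (X + k)\<close> in powers of \<open>X\<close>. If all its coefficients are
  below \<open>2 ^ l\<close>, they are the digits of \<open>R (2 ^ l + k)\<close> in base \<open>2 ^ l\<close>, and \<open>t\<close> is additive over
  digits. So \<open>t (R (2 ^ l + k))\<close> does not change when \<open>l\<close> grows, and the terms at \<open>2 ^ l + k\<close> and
  \<open>2 ^ Suc l + k\<close> agree as long as \<open>R (k + 1) < 2 ^ l\<close>, that is, for \<open>k\<close> up to the order of
  \<open>2 ^ (l / d)\<close>.

  It remains to see that the agreement ends within distance \<open>O(2 ^ l)\<close>: then all of this happens
  among the first \<open>N\<close> terms for some \<open>N\<close> of the order of \<open>2 ^ l\<close>, and the complexity is at least of
  the order of \<open>2 ^ (l / d)\<close>, which is that of \<open>N powr (1 / d)\<close>. If the agreement persisted, the sequence would have period \<open>2 ^ l\<close> on a long interval, and \<open>t (R (a * 2 ^ l))\<close>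
  would take the same value for all small \<open>a > 0\<close>. For large \<open>l\<close> that value is the sum of the
  \<open>t (coeff R j * a ^ j)\<close> over \<open>j\<close>. Take \<open>a = A (2 ^ u)\<close> with
  \<open>A = 3 + 3 X - X ^ 2 + 3 X ^ 3 + 3 X ^ 4\<close>. All powers \<open>A ^ j\<close> with \<open>j \<ge> 2\<close> have nonnegative
  coefficients, so their terms do not depend on \<open>u\<close> once \<open>u\<close> is large. For \<open>j = 1\<close>
  there is exactly one negative coefficient; the borrow it causes puts a block of ones into the
  binary expansion whose length grows by one with \<open>u\<close>. Hence replacing \<open>u\<close> by \<open>u + 1\<close> flips the
  sum (\<open>thue_morse_poly_multiples_differ\<close>), a contradiction.
\<close>

section \<open>Additivity of the Thue--Morse sequence over digits\<close>

lemma binary_digit_sum_eq_sum: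
  assumes "n < 2 ^ m"
  shows "binary_digit_sum n = (\<Sum>i<m. n div 2 ^ i mod 2)"
proof -
  have "{i. n div 2 ^ i mod 2 \<noteq> 0} \<subseteq> {..<m}"
  proof
    fix i assume "i \<in> {i. n div 2 ^ i mod 2 \<noteq> 0}"
    then have "\<not> n < 2 ^ i" by (intro notI) simp
    with assms have "(2::nat) ^ i < 2 ^ m" by linarith
    then show "i \<in> {..<m}" by simp
  qed
  then show ?thesis
    unfolding binary_digit_sum_def by (intro Sum_any.expand_superset) auto
qed

lemma binary_digit_sum_rec: "binary_digit_sum n = n mod 2 + binary_digit_sum (n div 2)"
proof -
  have n: "n < 2 ^ n" by (rule less_exp)
  then have "n < 2 ^ Suc n" unfolding power_Suc by linarith
  moreover have "n div 2 < 2 ^ n" using n by linarith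
  ultimately show ?thesis
    by (simp only: binary_digit_sum_eq_sum[of n "Suc n"] binary_digit_sum_eq_sum[of "n div 2" n])
      (simp add: sum.lessThan_Suc_shift div_mult2_eq del: sum.lessThan_Suc)
qed

lemma thue_morse_rec: "thue_morse n = of_nat (n mod 2) + thue_morse (n div 2)"
proof -
  have eq: "thue_morse m = of_nat (binary_digit_sum m)" for m
  proof -
    have "(of_nat (b mod 2) :: bit) = of_nat (b mod 2 + 2 * (b div 2))" for b
      by (simp only: of_nat_add of_nat_mult of_nat_numeral bit_2_eq_0 mult_zero_left add_0_right)
    then show ?thesis by (simp add: thue_morse_def)
  qed
  show ?thesis unfolding eq by (subst binary_digit_sum_rec) (rule of_nat_add)
qed

lemma thue_morse_0 [simp]: "thue_morse 0 = 0"
  by (simp add: thue_morse_def binary_digit_sum_eq_sum[of 0 0])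

lemma thue_morse_1 [simp]: "thue_morse (Suc 0) = 1"
  by (subst thue_morse_rec) simp

lemma thue_morse_add_shift:
  assumes "x < 2 ^ m"
  shows "thue_morse (x + 2 ^ m * y) = thue_morse x + thue_morse y"
  using assms
proof (induction m arbitrary: x)
  case (Suc m)
  have "(x + 2 ^ Suc m * y) div 2 = x div 2 + 2 ^ m * y"
    by simp
  moreover have "x div 2 < 2 ^ m" using Suc.prems by auto
  moreover have "(x + 2 ^ Suc m * y) mod 2 = x mod 2"
    by (simp add: mod_simps mult.assoc)
  ultimately show ?case
    using Suc.IH[of "x div 2"] thue_morse_rec[of x] thue_morse_rec[of "x + 2 ^ Suc m * y"]
    by (simp only: add.assoc)
qed simp

lemma thue_morse_sum_digits:
  assumes "\<And>i. i < n \<Longrightarrow> c i < 2 ^ m"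
  shows "thue_morse (\<Sum>i<n. c i * (2 ^ m) ^ i) = (\<Sum>i<n. thue_morse (c i))"
  using assms
proof (induction n arbitrary: c)
  case (Suc n)
  have "(\<Sum>i<Suc n. c i * (2 ^ m) ^ i) = c 0 + 2 ^ m * (\<Sum>i<n. c (Suc i) * (2 ^ m) ^ i)"
    by (simp add: sum.lessThan_Suc_shift sum_distrib_left algebra_simps del: sum.lessThan_Suc)
  then show ?case
    using Suc.IH[of "\<lambda>i. c (Suc i)"] Suc.prems
    by (simp add: thue_morse_add_shift sum.lessThan_Suc_shift del: sum.lessThan_Suc)
qed simp

lemma coeff_nat_le_poly_1: "coeff p i \<le> poly p (1::nat)"
proof (cases "i \<le> degree p")
  case True
  then show ?thesis by (auto simp: poly_altdef intro: member_le_sum)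
qed (simp add: coeff_eq_0)

text \<open>
  The value at \<open>1\<close> bounds every coefficient, so the coefficients are the base \<open>2 ^ m\<close> digits of the
  value at \<open>2 ^ m\<close>. The right-hand side is independent of \<open>m\<close>, which is how the lemma gets used.
\<close>
lemma thue_morse_poly_power_two:
  assumes "poly p 1 < 2 ^ m"
  shows "thue_morse (poly p (2 ^ m)) = (\<Sum>i\<le>degree p. thue_morse (coeff p i))"
proof -
  have "coeff p i < 2 ^ m" for i
    using coeff_nat_le_poly_1[of p i] assms by linarith
  then show ?thesis
    using thue_morse_sum_digits[of "Suc (degree p)" "coeff p" m]
    by (simp add: poly_altdef lessThan_Suc_atMost)
qed

section \<open>Repeated windows and maximum order complexity\<close>

text \<open>
  Only the last \<open>M\<close> of the \<open>k\<close> common terms are fed to the recurrence, so it must produce the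
  same next term at both places.
\<close>
lemma has_recurrence_repeated_window:
  assumes rec: "has_recurrence s N M" and "M \<le> k"
    and win: "\<And>h. h < k \<Longrightarrow> s (i + h) = s (j + h)"
    and N: "i + k < N" "j + k < N"
  shows "s (i + k) = s (j + k)"
proof -
  obtain f where f: "mpoly2_vars f \<subseteq> {..<M}"
    "\<And>i. i + M < N \<Longrightarrow> s (i + M) = mpoly2_eval f (\<lambda>j. s (i + j))"
    using rec unfolding has_recurrence_def by blast
  define m where "m = k - M"
  have k: "k = m + M" using \<open>M \<le> k\<close> by (simp add: m_def)
  have "mpoly2_eval f (\<lambda>h. s (i + m + h)) = mpoly2_eval f (\<lambda>h. s (j + m + h))"
    unfolding mpoly2_eval_def
  proof (intro sum.cong prod.cong refl arg_cong2[where f = "(*)"] arg_cong2[where f = "(^)"])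
    fix x h assume "x \<in> Poly_Mapping.keys f" "h \<in> Poly_Mapping.keys x"
    then have "h < M" using f(1) by (auto simp: mpoly2_vars_def)
    then show "s (i + m + h) = s (j + m + h)"
      using win[of "m + h"] k by (simp add: add.assoc)
  qed
  then show ?thesis using f(2)[of "i + m"] f(2)[of "j + m"] N k by (simp add: add.assoc)
qed

lemma max_order_complexity_gt:
  assumes win: "\<And>h. h < k \<Longrightarrow> s (i + h) = s (j + h)"
    and diff: "s (i + k) \<noteq> s (j + k)"
    and N: "i + k < N - 1" "j + k < N - 1"
  shows "k < max_order_complexity s N"
proof -
  have nconst: "\<not> (\<forall>i<N - 1. s i = s 0)"
    using N diff by metis
  define M where "M = (LEAST M. M > 0 \<and> has_recurrence s N M)"
  have "\<exists>M>0. has_recurrence s N M"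
    by (rule has_recurrence_exists) (use N in linarith)
  then have "has_recurrence s N M"
    unfolding M_def by (rule LeastI2_ex) blast
  then have "\<not> M \<le> k"
    using has_recurrence_repeated_window[of s N M k i j] win diff N
    by (meson diff_le_self order_less_le_trans)
  then show ?thesis
    using nconst unfolding max_order_complexity_def M_def by (simp only: if_False not_le)
qed

section \<open>Agreement just after consecutive powers of two\<close>

text \<open>
  The coefficients of \<open>R (X + k)\<close> add up to \<open>R (k + 1)\<close>, so under the hypothesis they are the digits of
  both arguments, in base \<open>2 ^ l\<close> and in base \<open>2 ^ Suc l\<close> respectively.
\<close>
lemma thue_morse_poly_near_power_two:
  fixes R :: "nat poly"
  assumes "poly R (Suc k) < 2 ^ l"
  shows "thue_morse (poly R (2 ^ l + k)) = thue_morse (poly R (2 ^ Suc l + k))"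
proof -
  let ?S = "pcompose R [:k, 1:]"
  have "poly ?S 1 < 2 ^ l" using assms by (simp add: poly_pcompose)
  then have *: "poly ?S 1 < 2 ^ l" "poly ?S 1 < 2 ^ Suc l" by auto
  have "poly R (2 ^ m + k) = poly ?S (2 ^ m)" for m
    by (simp add: poly_pcompose add.commute)
  then show ?thesis
    using *[THEN thue_morse_poly_power_two] by (simp del: power_Suc)
qed

section \<open>A multiplier with a single borrow\<close>

text \<open>
  The polynomial \<open>3 + 3 X - X ^ 2 + 3 X ^ 3 + 3 X ^ 4\<close>, with \<open>- X ^ 2 + 3 X ^ 3\<close> written as
  \<open>(3 X - 1) X ^ 2\<close> so that the subtraction on natural numbers is not truncated for \<open>x > 0\<close>.
\<close>
definition multiplier :: "nat \<Rightarrow> nat" where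
  "multiplier x = 3 + 3 * x + (3 * x - 1) * x ^ 2 + 3 * x ^ 4"

text \<open>
  The term \<open>- X ^ 2\<close> is outweighed by its neighbours in the square and the cube, whose coefficients
  are all positive (in the square, those of \<open>X ^ 2\<close> and \<open>X ^ 3\<close> are \<open>9 - 6\<close> and \<open>18 - 6\<close>);
  every exponent from two on is a sum of twos and threes.
\<close>
lemma multiplier_power_nonneg_coeffs:
  "\<exists>B :: nat poly. \<forall>x>0. multiplier x ^ (j + 2) = poly B x"
proof (induction j rule: induct_nat_012)
  have int: "int (multiplier x) = 3 + 3 * int x - int x ^ 2 + 3 * int x ^ 3 + 3 * int x ^ 4"
    if "x > 0" for x
  proof -
    have "int (3 * x - 1) = 3 * int x - 1" using that by simp
    then show ?thesis
      unfolding multiplier_def of_nat_add of_nat_mult of_nat_power of_nat_numeral by algebra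
  qed
  let ?B = "[:9, 18, 3, 12, 37, 12, 3, 18, 9:] :: nat poly"
  let ?C = "[:27, 81, 54, 54, 225, 198, 53, 198, 225, 54, 54, 81, 27:] :: nat poly"
  have 2: "multiplier x ^ 2 = poly ?B x" if "x > 0" for x
  proof -
    have "int (multiplier x ^ 2) = int (poly ?B x)"
      by (simp add: int[OF that]) algebra
    then show ?thesis by (simp only: of_nat_eq_iff)
  qed
  have 3: "multiplier x ^ 3 = poly ?C x" if "x > 0" for x
  proof -
    have "int (multiplier x ^ 3) = int (poly ?C x)"
      by (simp add: int[OF that]) algebra
    then show ?thesis by (simp only: of_nat_eq_iff)
  qed
  show "\<exists>B :: nat poly. \<forall>x>0. multiplier x ^ (0 + 2) = poly B x"
    unfolding add_0_left using 2 by blast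
  show "\<exists>B :: nat poly. \<forall>x>0. multiplier x ^ (Suc 0 + 2) = poly B x"
    using 3 by (intro exI[of _ ?C]) (simp del: poly_pCons add: numeral_3_eq_3)
  fix n assume "\<exists>B :: nat poly. \<forall>x>0. multiplier x ^ (n + 2) = poly B x"
  then obtain B :: "nat poly" where B: "\<forall>x>0. multiplier x ^ (n + 2) = poly B x" by blast
  have "multiplier x ^ (Suc (Suc n) + 2) = poly (?B * B) x" if "x > 0" for x
  proof -
    have "multiplier x ^ (Suc (Suc n) + 2) = multiplier x ^ 2 * multiplier x ^ (n + 2)"
      by (simp flip: power_add)
    then show ?thesis using 2[OF that] B that by (simp only: poly_mult)
  qed
  then show "\<exists>B :: nat poly. \<forall>x>0. multiplier x ^ (Suc (Suc n) + 2) = poly B x" by blast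
qed

lemma eventually_const_less_power_two: "eventually (\<lambda>u. (K::nat) < 2 ^ u) sequentially"
proof (rule eventually_sequentiallyI[of K])
  fix u assume "K \<le> u"
  then show "K < 2 ^ u" using less_exp[of u] by linarith
qed

lemma thue_morse_multiplier_power:
  "eventually (\<lambda>u. thue_morse (q * multiplier (2 ^ Suc u) ^ (j + 2))
                 = thue_morse (q * multiplier (2 ^ u) ^ (j + 2))) sequentially"
proof -
  obtain B :: "nat poly" where B: "\<forall>x>0. multiplier x ^ (j + 2) = poly B x"
    using multiplier_power_nonneg_coeffs by blast
  have val: "q * multiplier (2 ^ u) ^ (j + 2) = poly (smult q B) (2 ^ u)" for u
    using B by simp
  show ?thesis
    using eventually_const_less_power_two[of "poly (smult q B) 1"]
  proof eventually_elim
    case (elim u)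
    then have "poly (smult q B) 1 < 2 ^ Suc u" by simp
    with elim show ?case
      by (simp only: val thue_morse_poly_power_two)
  qed
qed

text \<open>
  In base \<open>x = 2 ^ u\<close> the negative digit \<open>- q\<close> of \<open>q * multiplier x\<close> becomes \<open>x - q\<close>, and one is
  borrowed from the next digit. Only the digit \<open>x - q\<close> depends on \<open>u\<close>, and passing to \<open>u + 1\<close> adds
  the single binary digit \<open>2 ^ u\<close> to it.
\<close>
lemma thue_morse_multiplier_flip:
  assumes "q > 0"
  shows "eventually (\<lambda>u. thue_morse (q * multiplier (2 ^ Suc u))
                       = thue_morse (q * multiplier (2 ^ u)) + 1) sequentially"
proof -
  define w where "w u = thue_morse (q * multiplier (2 ^ u))" for u
  have w: "w u = thue_morse (3 * q) + thue_morse (3 * q) + thue_morse (2 ^ u - q)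
      + thue_morse (3 * q - 1) + thue_morse (3 * q)"
    if u: "3 * q < 2 ^ u" for u
  proof -
    define x :: nat where "x = 2 ^ u"
    have x: "3 * q < x" using u by (simp add: x_def)
    have "int (q * multiplier x)
        = int (3 * q + 3 * q * x + (x - q) * x ^ 2 + (3 * q - 1) * x ^ 3 + 3 * q * x ^ 4)"
    proof -
      have "int (3 * x - 1) = 3 * int x - 1" "int (x - q) = int x - int q"
        "int (3 * q - 1) = 3 * int q - 1"
        using x assms by auto
      then show ?thesis
        unfolding multiplier_def of_nat_add of_nat_mult of_nat_power of_nat_numeral by algebra
    qed
    then have eq: "q * multiplier x
        = 3 * q + 3 * q * x + (x - q) * x ^ 2 + (3 * q - 1) * x ^ 3 + 3 * q * x ^ 4"
      by (simp only: of_nat_eq_iff)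
    have "w u = thue_morse (\<Sum>i<5. [3 * q, 3 * q, x - q, 3 * q - 1, 3 * q] ! i * (2 ^ u) ^ i)"
      unfolding w_def x_def[symmetric] eq by (simp add: eval_nat_numeral)
    also have "\<dots> = (\<Sum>i<5. thue_morse ([3 * q, 3 * q, x - q, 3 * q - 1, 3 * q] ! i))"
    proof (rule thue_morse_sum_digits)
      fix i :: nat assume "i < 5"
      then have "i \<in> {0, 1, 2, 3, 4}" by auto
      then show "[3 * q, 3 * q, x - q, 3 * q - 1, 3 * q] ! i < 2 ^ u"
        using x assms unfolding x_def[symmetric] by auto
    qed
    finally show ?thesis
      by (simp add: x_def eval_nat_numeral del: add_bit_eq_xor)
  qed
  show ?thesis
    using eventually_const_less_power_two[of "3 * q"]
  proof eventually_elim
    case (elim u)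
    have "2 ^ Suc u - q = (2 ^ u - q) + 2 ^ u * 1"
      using elim by simp
    then have "thue_morse (2 ^ Suc u - q) = thue_morse (2 ^ u - q) + 1"
      using elim assms thue_morse_add_shift[of "2 ^ u - q" u 1] by simp
    moreover have "3 * q < 2 ^ Suc u" using elim by simp
    ultimately have "w (Suc u) = w u + 1"
      using w[of u] w[of "Suc u"] elim by (simp only: ac_simps)
    then show ?case by (simp add: w_def)
  qed
qed

section \<open>Disagreement within a bounded number of periods\<close>

text \<open>
  The witnesses are \<open>multiplier (2 ^ u)\<close> and \<open>multiplier (2 ^ Suc u)\<close> for one sufficiently large \<open>u\<close>.
  For large \<open>l\<close> the digits of \<open>R (c * 2 ^ l)\<close> in base \<open>2 ^ l\<close> are \<open>coeff R j * c ^ j\<close>; only the linear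
  one has a value of \<open>t\<close> that differs between the two witnesses.
\<close>
lemma thue_morse_poly_multiples_differ:
  fixes R :: "nat poly"
  assumes "coeff R 1 > 0"
  shows "\<exists>a b. 0 < a \<and> 0 < b \<and>
    eventually (\<lambda>l. thue_morse (poly R (a * 2 ^ l)) \<noteq> thue_morse (poly R (b * 2 ^ l))) sequentially"
proof -
  let ?d = "degree R"
  have d: "?d \<ge> 1" using assms by (intro le_degree) simp
  have "eventually (\<lambda>u. \<forall>j\<in>{..?d} - {1}.
      thue_morse (coeff R j * multiplier (2 ^ Suc u) ^ j)
      = thue_morse (coeff R j * multiplier (2 ^ u) ^ j)) sequentially"
  proof (rule eventually_ball_finite, simp, rule ballI)
    fix j assume j: "j \<in> {..?d} - {1}"
    show "eventually (\<lambda>u. thue_morse (coeff R j * multiplier (2 ^ Suc u) ^ j)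
      = thue_morse (coeff R j * multiplier (2 ^ u) ^ j)) sequentially"
    proof (cases "j = 0")
      case False
      then have "j = (j - 2) + 2" using j by auto
      then show ?thesis using thue_morse_multiplier_power[of "coeff R j" "j - 2"] by metis
    qed simp
  qed
  then have "eventually (\<lambda>u. (\<forall>j\<in>{..?d} - {1}.
      thue_morse (coeff R j * multiplier (2 ^ Suc u) ^ j)
      = thue_morse (coeff R j * multiplier (2 ^ u) ^ j)) \<and>
      thue_morse (coeff R 1 * multiplier (2 ^ Suc u))
      = thue_morse (coeff R 1 * multiplier (2 ^ u)) + 1) sequentially"
    using thue_morse_multiplier_flip[OF assms] by (rule eventually_conj)
  then obtain u where u: "\<And>j. j \<in> {..?d} - {1} \<Longrightarrow>
      thue_morse (coeff R j * multiplier (2 ^ Suc u) ^ j)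
      = thue_morse (coeff R j * multiplier (2 ^ u) ^ j)"
    "thue_morse (coeff R 1 * multiplier (2 ^ Suc u))
      = thue_morse (coeff R 1 * multiplier (2 ^ u)) + 1"
    using eventually_happens'[OF sequentially_bot] by blast
  let ?a = "multiplier (2 ^ u)" and ?b = "multiplier (2 ^ Suc u)"
  have val: "thue_morse (poly R (c * 2 ^ l)) = (\<Sum>j\<le>?d. thue_morse (coeff R j * c ^ j))"
    if "poly R c < 2 ^ l" for c l
  proof -
    have "coeff R j * c ^ j < 2 ^ l" if "j \<le> ?d" for j
    proof -
      have "coeff R j * c ^ j \<le> poly R c"
        unfolding poly_altdef using that by (intro member_le_sum) auto
      then show ?thesis using \<open>poly R c < 2 ^ l\<close> by linarith
    qed
    then show ?thesis
      using thue_morse_sum_digits[of "Suc ?d" "\<lambda>j. coeff R j * c ^ j" l]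
      by (simp add: poly_altdef lessThan_Suc_atMost power_mult_distrib mult.assoc)
  qed
  have sums: "(\<Sum>j\<le>?d. thue_morse (coeff R j * ?b ^ j))
      = (\<Sum>j\<le>?d. thue_morse (coeff R j * ?a ^ j)) + 1"
    using u d by (subst (1 2) sum.remove[of _ 1])
      (auto intro!: sum.cong simp: add.commute add.left_commute simp del: power_Suc)
  have "eventually (\<lambda>l. thue_morse (poly R (?a * 2 ^ l)) \<noteq> thue_morse (poly R (?b * 2 ^ l)))
      sequentially"
    using eventually_const_less_power_two[of "poly R ?a"]
      eventually_const_less_power_two[of "poly R ?b"]
    by eventually_elim (simp add: val sums del: power_Suc)
  moreover have "0 < ?a" "0 < ?b" by (simp_all add: multiplier_def)
  ultimately show ?thesis by blast
qed

text \<open>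
  Agreement for all these \<open>k\<close> would be periodicity with period \<open>2 ^ l\<close>, giving all multiples
  \<open>c * 2 ^ l\<close> with \<open>0 < c \<le> a + b\<close> the same value. The constant \<open>C\<close> must not depend
  on \<open>l\<close>: it determines the implied constant of the final bound.
\<close>
lemma eventually_not_two_power_periodic:
  fixes R :: "nat poly"
  assumes "coeff R 1 > 0"
  shows "\<exists>C. eventually (\<lambda>l. \<exists>k. k < C * 2 ^ l \<and>
    thue_morse (poly R (2 ^ l + k)) \<noteq> thue_morse (poly R (2 ^ Suc l + k))) sequentially"
proof -
  obtain a b where ab: "0 < a" "0 < b"
    "eventually (\<lambda>l. thue_morse (poly R (a * 2 ^ l)) \<noteq> thue_morse (poly R (b * 2 ^ l))) sequentially"
    using thue_morse_poly_multiples_differ[OF assms] by blast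
  have "eventually (\<lambda>l. \<exists>k. k < (a + b) * 2 ^ l \<and>
    thue_morse (poly R (2 ^ l + k)) \<noteq> thue_morse (poly R (2 ^ Suc l + k))) sequentially"
    using ab(3)
  proof eventually_elim
    case (elim l)
    show ?case
    proof (rule ccontr)
      assume "\<not> ?thesis"
      then have per: "thue_morse (poly R (2 ^ l + k)) = thue_morse (poly R (2 ^ Suc l + k))"
        if "k < (a + b) * 2 ^ l" for k using that by blast
      have const: "thue_morse (poly R (Suc c * 2 ^ l)) = thue_morse (poly R (2 ^ l))"
        if "c < a + b" for c
        using that
      proof (induction c)
        case (Suc c)
        have "c * 2 ^ l < (a + b) * 2 ^ l" using Suc.prems by simp
        note per[OF this, symmetric]
        moreover have "Suc (Suc c) * 2 ^ l = 2 ^ Suc l + c * 2 ^ l"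
          "2 ^ l + c * 2 ^ l = Suc c * 2 ^ l" by simp_all
        ultimately show ?case using Suc by (simp only: Suc_lessD)
      qed simp
      from const[of "a - 1"] const[of "b - 1"] ab(1,2) elim show False by simp
    qed
  qed
  then show ?thesis by blast
qed

section \<open>Making all coefficients positive\<close>

text \<open>
  Induction along the Horner scheme: if \<open>P = a + X p\<close>, then
  \<open>P (X + k) = a + k * p (X + k) + X * p (X + k)\<close>. The last summand makes all coefficients but the
  constant one positive, and the middle one outweighs \<open>a\<close> as soon as \<open>k > \<bar>a\<bar>\<close>.
\<close>
lemma shifted_coeffs_eventually_pos:
  fixes P :: "int poly"
  assumes "lead_coeff P > 0"
  shows "eventually (\<lambda>k. \<forall>i\<le>degree P. coeff (pcompose P [:int k, 1:]) i > 0) sequentially"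
  using assms
proof (induction P)
  case (pCons a p)
  show ?case
  proof (cases "p = 0")
    case True
    then show ?thesis using pCons.prems by simp
  next
    case False
    then have "eventually (\<lambda>k. \<forall>i\<le>degree p. coeff (pcompose p [:int k, 1:]) i > 0) sequentially"
      using pCons by simp
    then show ?thesis
      using eventually_ge_at_top[of "nat (\<bar>a\<bar> + 1)"]
    proof eventually_elim
      case (elim k)
      let ?S = "pcompose p [:int k, 1:]"
      have S: "coeff ?S i \<ge> 0" for i
      proof (cases "i \<le> degree p")
        case False
        have "degree ?S = degree p" by (simp add: degree_pcompose)
        with False show ?thesis by (simp add: coeff_eq_0)
      qed (use elim in \<open>auto intro: less_imp_le\<close>)
      have k: "int k \<ge> \<bar>a\<bar> + 1" using elim(2) by linarith
      have k1: "int k \<le> int k * coeff ?S 0"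
        using elim(1) mult_left_mono[of 1 "coeff ?S 0" "int k"] by force
      show ?case
      proof (intro allI impI)
        fix i assume i: "i \<le> degree (pCons a p)"
        show "coeff (pcompose (pCons a p) [:int k, 1:]) i > 0"
        proof (cases i)
          case 0
          then show ?thesis using k k1 by (simp add: pcompose_pCons)
        next
          case (Suc m)
          then have "coeff ?S m > 0" using i elim(1) False by simp
          moreover have "int k * coeff ?S (Suc m) \<ge> 0" using S by simp
          ultimately show ?thesis using Suc by (simp add: pcompose_pCons)
        qed
      qed
    qed
  qed
qed simp

lemma shifted_nat_poly:
  fixes P :: "int poly"
  assumes "lead_coeff P > 0"
  obtains k0 :: nat and R :: "nat poly"
  where "degree R = degree P" "\<And>i. i \<le> degree P \<Longrightarrow> coeff R i > 0"
    "\<And>n. poly P (int (k0 + n)) = int (poly R n)"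
proof -
  obtain k0 where k0: "\<forall>i\<le>degree P. coeff (pcompose P [:int k0, 1:]) i > 0"
    using eventually_happens'[OF sequentially_bot shifted_coeffs_eventually_pos[OF assms]] by blast
  let ?S = "pcompose P [:int k0, 1:]"
  define R where "R = map_poly nat ?S"
  have deg: "degree ?S = degree P" by (simp add: degree_pcompose)
  have R: "coeff R i = nat (coeff ?S i)" for i
    by (simp add: R_def coeff_map_poly)
  have degR: "degree R = degree P"
  proof (rule antisym)
    show "degree R \<le> degree P" by (rule degree_le) (simp add: R deg coeff_eq_0)
    show "degree P \<le> degree R" using k0[rule_format, of "degree P"] by (intro le_degree) (simp add: R)
  qed
  have "poly P (int (k0 + n)) = int (poly R n)" for n
  proof -
    have "poly P (int (k0 + n)) = poly ?S (int n)" by (simp add: poly_pcompose add.commute)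
    also have "\<dots> = (\<Sum>i\<le>degree P. coeff ?S i * int n ^ i)"
      by (simp add: poly_altdef deg)
    also have "\<dots> = (\<Sum>i\<le>degree P. int (coeff R i) * int n ^ i)"
      using k0 by (intro sum.cong) (auto simp: R less_imp_le)
    also have "\<dots> = int (poly R n)" by (simp add: poly_altdef degR)
    finally show ?thesis .
  qed
  with degR k0 show ?thesis by (intro that) (auto simp: R)
qed

section \<open>The lower bound\<close>

lemma poly_nat_le_power:
  fixes R :: "nat poly"
  assumes "n > 0"
  shows "poly R n \<le> poly R 1 * n ^ degree R"
proof -
  have "coeff R i * n ^ i \<le> coeff R i * n ^ degree R" if "i \<le> degree R" for i
    using assms that by (intro mult_left_mono power_increasing) auto
  then show ?thesis
    by (auto simp: poly_altdef sum_distrib_right intro!: sum_mono)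
qed

theorem theorem3:
  fixes P :: "int poly" and d :: nat
  assumes "d \<ge> 2"
    and "degree P = d"
    and "lead_coeff P = 1"
    and "poly P ` \<nat> \<subseteq> \<nat>"
  shows "\<exists>c::real. c > 0 \<and> (\<exists>N0::nat. \<forall>N\<ge>N0.
    real (max_order_complexity (thue_morse_along P) N) \<ge> c * real N powr (1 / real d))"
proof -
  let ?s = "thue_morse_along P"
  have "lead_coeff P > 0" using assms(3) by simp
  then obtain k0 :: nat and R :: "nat poly" where R: "degree R = degree P"
    "\<And>i. i \<le> degree P \<Longrightarrow> coeff R i > 0" "\<And>n. poly P (int (k0 + n)) = int (poly R n)"
    by (rule shifted_nat_poly) (rule that)
  have s: "?s (k0 + n) = thue_morse (poly R n)" for n
    using R(3)[of n] by (simp add: thue_morse_along_def)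
  have "coeff R 1 > 0" using R(2)[of 1] assms(1,2) by simp
  then obtain C l0 where C: "\<And>l. l \<ge> l0 \<Longrightarrow> \<exists>k. k < C * 2 ^ l \<and>
      thue_morse (poly R (2 ^ l + k)) \<noteq> thue_morse (poly R (2 ^ Suc l + k))"
    using eventually_not_two_power_periodic unfolding eventually_sequentially by meson
  \<comment> \<open>The two windows and the term after them lie below \<open>B * 2 ^ l\<close>: the shift \<open>k0\<close>, the starting
    point \<open>2 ^ Suc l\<close> and the length \<open>k < C * 2 ^ l\<close> take \<open>C + k0 + 2\<close>, and the rest is slack.\<close>
  define B where "B = C + k0 + 4"
  define K where "K = 2 * B * poly R 1"
  have "coeff R 1 \<le> poly R 1" by (rule coeff_nat_le_poly_1)
  then have K: "K > 0" using \<open>coeff R 1 > 0\<close> by (simp add: K_def B_def)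
  have main: "N \<le> K * max_order_complexity ?s N ^ d" if N: "N \<ge> B * 2 ^ l0" for N
  proof -
    \<comment> \<open>Choose \<open>l\<close> with \<open>B * 2 ^ l \<le> N < B * 2 ^ Suc l\<close>.\<close>
    have ex: "\<exists>l. N < B * 2 ^ Suc l"
    proof
      have "N < 2 ^ N" by simp
      also have "2 ^ N \<le> B * 2 ^ Suc N" by (simp add: B_def)
      finally show "N < B * 2 ^ Suc N" .
    qed
    define l where "l = (LEAST l. N < B * 2 ^ Suc l)"
    have l: "N < B * 2 ^ Suc l" unfolding l_def using ex by (rule LeastI_ex)
    have l': "B * 2 ^ l \<le> N \<and> l0 \<le> l"
    proof (cases l)
      case 0
      have "B * 2 ^ l0 < B * 2 ^ Suc l" using N l by linarith
      then have "(2::nat) ^ l0 < 2 ^ Suc l" by simp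
      then have "l0 \<le> l" by (simp del: power_Suc)
      then show ?thesis using N 0 by simp
    next
      case (Suc m)
      have "B * 2 ^ l0 < B * 2 ^ Suc l" using N l by linarith
      then have "(2::nat) ^ l0 < 2 ^ Suc l" by simp
      then have "l0 \<le> l" by (simp del: power_Suc)
      moreover have "\<not> N < B * 2 ^ Suc m"
        using not_less_Least[of m "\<lambda>l. N < B * 2 ^ Suc l"] Suc by (simp add: l_def)
      ultimately show ?thesis using Suc by simp
    qed
    \<comment> \<open>The first disagreement ends the repeated window.\<close>
    define k where "k = (LEAST k. thue_morse (poly R (2 ^ l + k)) \<noteq> thue_morse (poly R (2 ^ Suc l + k)))"
    obtain k' where k': "k' < C * 2 ^ l"
      "thue_morse (poly R (2 ^ l + k')) \<noteq> thue_morse (poly R (2 ^ Suc l + k'))"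
      using C l' by blast
    have k: "thue_morse (poly R (2 ^ l + k)) \<noteq> thue_morse (poly R (2 ^ Suc l + k))"
      unfolding k_def using k'(2) by (rule LeastI)
    have "k \<le> k'" unfolding k_def using k'(2) by (rule Least_le)
    then have kC: "k < C * 2 ^ l" using k'(1) by linarith
    have small: "thue_morse (poly R (2 ^ l + h)) = thue_morse (poly R (2 ^ Suc l + h))" if "h < k" for h
      using not_less_Least[of h "\<lambda>k. thue_morse (poly R (2 ^ l + k)) \<noteq> thue_morse (poly R (2 ^ Suc l + k))"] that
      unfolding k_def by blast
    have one: "(1::nat) \<le> 2 ^ l" by simp
    have "k0 * 1 \<le> k0 * 2 ^ l" by (intro mult_left_mono) auto
    then have fits: "k0 + 2 ^ Suc l + k < N - 1"
    proof -
      have "B * 2 ^ l = C * 2 ^ l + k0 * 2 ^ l + 4 * 2 ^ l" by (simp add: B_def algebra_simps)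
      then have "k0 + 2 ^ Suc l + k + 1 < N"
        using l' kC one \<open>k0 * 1 \<le> k0 * 2 ^ l\<close> unfolding power_Suc by linarith
      then show ?thesis by linarith
    qed
    have M: "k < max_order_complexity ?s N"
    proof (rule max_order_complexity_gt)
      show "?s (k0 + 2 ^ l + h) = ?s (k0 + 2 ^ Suc l + h)" if "h < k" for h
        using small[OF that] by (simp only: s add.assoc)
      show "?s (k0 + 2 ^ l + k) \<noteq> ?s (k0 + 2 ^ Suc l + k)"
        using k by (simp only: s add.assoc not_False_eq_True)
      show "k0 + 2 ^ Suc l + k < N - 1" by (fact fits)
      then show "k0 + 2 ^ l + k < N - 1" by simp
    qed
    \<comment> \<open>A disagreement at \<open>k\<close> is possible only once the digits overlap.\<close>
    have "2 ^ l \<le> poly R (Suc k)"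
      using thue_morse_poly_near_power_two[of R k l] k by (meson not_le)
    also have "\<dots> \<le> poly R 1 * Suc k ^ d"
      using poly_nat_le_power[of "Suc k" R] R(1) assms(2) by simp
    also have "\<dots> \<le> poly R 1 * max_order_complexity ?s N ^ d"
      using M by (intro mult_left_mono power_mono) auto
    finally have "2 * B * 2 ^ l \<le> 2 * B * (poly R 1 * max_order_complexity ?s N ^ d)"
      by (rule mult_left_mono) simp
    moreover have "N < 2 * B * 2 ^ l" using l by (simp add: ac_simps)
    ultimately have "N \<le> 2 * B * (poly R 1 * max_order_complexity ?s N ^ d)" by linarith
    then show ?thesis by (simp only: K_def mult.assoc)
  qed
  define c where "c = (1 / real K) powr (1 / real d)"
  have "c > 0" using K by (simp add: c_def)
  moreover have "c * real N powr (1 / real d) \<le> real (max_order_complexity ?s N)"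
    if "N \<ge> B * 2 ^ l0" for N
  proof -
    let ?M = "max_order_complexity ?s N"
    have "N > 0" using that by (rule less_le_trans[rotated]) (simp add: B_def)
    then have M: "?M > 0" using main[OF that] assms(1) by (cases "?M = 0") (auto simp: power_0_left)
    have "real N \<le> real K * real ?M ^ d"
      using main[OF that] by (simp flip: of_nat_power of_nat_mult)
    then have le: "1 / real K * real N \<le> real ?M ^ d"
      using K by (simp add: field_simps)
    have "c * real N powr (1 / real d) = (1 / real K * real N) powr (1 / real d)"
      unfolding c_def by (subst powr_mult) auto
    also have "\<dots> \<le> (real ?M ^ d) powr (1 / real d)"
      using le by (intro powr_mono2) auto
    also have "\<dots> = real ?M"
      using M assms(1) by (simp add: powr_powr flip: powr_realpow)
    finally show ?thesis .
  qed
  ultimately show ?thesis by blast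
qed

end
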